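(* Let $t\geq 1$ be an integer and let $A$ be a zero-one matrix which contains at most $t$ $1$-entries in each row. Then $\operatorname{ex}(n,A)\leq n^{2-\frac{1}{t}+o(1)}$ as $n\to\infty$ (with $t$ and $A$ fixed); that is, for every $\varepsilon>0$ there exists $n_0$ such that $\operatorname{ex}(n,A)\leq n^{2-\frac{1}{t}+\varepsilon}$ for all $n\geq n_0$.
   Context: A zero-one matrix is a (finite) matrix all of whose entries are $0$ or $1$. For zero-one matrices $A$ and $M$, we say that $M$ contains $A$ if, by deleting some (possibly no) rows and columns from $M$, and possibly turning some of its $1$-entries into $0$-entries, we can obtain $A$ (the order of the remaining rows and columns is kept). The weight of a zero-one matrix is the number of its $1$-entries. The extremal number $\operatorname{ex}(n,A)$ of a zero-one matrix $A$ is the maximum possible weight of an $n\times n$ zero-one matrix that does not contain $A$. *)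

theory Defs
  imports Complex_Main "Jordan_Normal_Form.DL_Submatrix"
begin

definition zero_one_mat :: "nat mat \<Rightarrow> bool" where
  "zero_one_mat M \<longleftrightarrow> elements_mat M \<subseteq> {0, 1}"

text \<open>The sets \<open>I\<close> and \<open>J\<close> are the rows and columns of \<open>M\<close> that are kept; \<open>submatrix\<close>
  keeps them in their original order. For zero-one matrices of equal dimensions, \<open>A\<close> arises from
  \<open>B\<close> by turning some \<open>1\<close>-entries into \<open>0\<close>-entries iff each \<open>1\<close>-entry of \<open>A\<close> is one of \<open>B\<close>.\<close>

definition mat_contains :: "nat mat \<Rightarrow> nat mat \<Rightarrow> bool" where
  "mat_contains M A \<longleftrightarrow>
     (\<exists>I J. I \<subseteq> {..<dim_row M} \<and> J \<subseteq> {..<dim_col M} \<and>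
        (let B = submatrix M I J in
           dim_row B = dim_row A \<and> dim_col B = dim_col A \<and>
           (\<forall>i<dim_row A. \<forall>j<dim_col A. A $$ (i, j) = 1 \<longrightarrow> B $$ (i, j) = 1)))"

definition weight :: "nat mat \<Rightarrow> nat" where
  "weight M = card {(i, j). i < dim_row M \<and> j < dim_col M \<and> M $$ (i, j) = 1}"

definition row_weight :: "nat mat \<Rightarrow> nat \<Rightarrow> nat" where
  "row_weight M i = card {j. j < dim_col M \<and> M $$ (i, j) = 1}"

definition avoiding_mats :: "nat \<Rightarrow> nat mat \<Rightarrow> nat mat set" where
  "avoiding_mats n A = {M \<in> carrier_mat n n. zero_one_mat M \<and> \<not> mat_contains M A}"

text \<open>\<open>Sup\<close> on \<^typ>\<open>nat\<close> is the maximum of a nonempty finite set (see \<open>extremal_number_eq_Max\<close>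
  below) and \<open>0\<close> on the empty set. The latter is the convention used if every \<open>n \<times> n\<close> zero-one
  matrix contains \<open>A\<close>, which happens only when \<open>A\<close> has no \<open>1\<close>-entry.\<close>

definition extremal_number :: "nat \<Rightarrow> nat mat \<Rightarrow> nat" where
  "extremal_number n A = Sup (weight ` avoiding_mats n A)"

lemma finite_weight_avoiding_mats: "finite (weight ` avoiding_mats n A)"
proof (rule finite_subset)
  show "weight ` avoiding_mats n A \<subseteq> {..n * n}"
  proof (clarsimp simp: avoiding_mats_def)
    fix M :: "nat mat" assume "M \<in> carrier_mat n n"
    hence "weight M \<le> card ({..<n} \<times> {..<n})"
      unfolding weight_def by (intro card_mono) auto
    thus "weight M \<le> n * n" by simp
  qed
qed simp

lemma extremal_number_eq_Max:
  "avoiding_mats n A \<noteq> {} \<Longrightarrow> extremal_number n A = Max (weight ` avoiding_mats n A)"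
  unfolding extremal_number_def
  by (intro cSup_eq_Max finite_weight_avoiding_mats) simp

lemma avoiding_mats_nonempty:
  assumes "i < dim_row A" "j < dim_col A" "A $$ (i, j) = 1"
  shows "avoiding_mats n A \<noteq> {}"
proof -
  have "\<not> mat_contains (0\<^sub>m n n) A"
  proof
    assume "mat_contains (0\<^sub>m n n) A"
    then obtain I J where IJ: "I \<subseteq> {..<n}" "J \<subseteq> {..<n}"
      and r: "dim_row (submatrix (0\<^sub>m n n :: nat mat) I J) = dim_row A"
      and c: "dim_col (submatrix (0\<^sub>m n n :: nat mat) I J) = dim_col A"
      and e: "submatrix (0\<^sub>m n n :: nat mat) I J $$ (i, j) = 1"
      using assms by (auto simp: mat_contains_def Let_def)
    have "{a. a < n \<and> a \<in> I} = I" "{a. a < n \<and> a \<in> J} = J" using IJ by auto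
    hence i: "i < card {a. a < n \<and> a \<in> I}" "i < card I"
      and j: "j < card {a. a < n \<and> a \<in> J}" "j < card J"
      using r c assms by (simp_all add: dim_submatrix)
    have "pick I i < n" "pick J j < n"
      using pick_in_set[of i I] pick_in_set[of j J] i j IJ by auto
    thus False using e i j by (simp add: submatrix_index)
  qed
  moreover have "zero_one_mat (0\<^sub>m n n)" by (auto simp: zero_one_mat_def)
  ultimately show ?thesis by (auto simp: avoiding_mats_def)
qed

end

theory Submission
  imports Defs "HOL-Library.Ramsey" "HOL-Real_Asymp.Real_Asymp"
begin

text \<open>Fix an integer \<open>L\<close>, let \<open>k\<close> be the number of rows of \<open>A\<close>, and let \<open>K\<close> be about
  \<open>n\<^sup>1\<^sup>/\<^sup>L\<close>, so that every distance between two of the \<open>n\<close> rows of \<open>M\<close> lies in one of the \<open>L\<close>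
  scales \<open>[K ^ l, K ^ (l + 1))\<close>. If a set \<open>D\<close> of rows is given, then all but \<open>2 ^ L * K ^ k\<close> rows
  \<open>r\<close> of \<open>D\<close> have elements of \<open>D\<close> to their left (that is, above them) at \<open>k\<close> different scales.
  Apply this to the sets of common rows of the \<open>t\<close>-sets \<open>T\<close> of columns. If \<open>M\<close> is heavy, then
  by convexity there are far more than \<open>n ^ t * K ^ k\<close> pairs \<open>(r, T)\<close> such that row \<open>r\<close> has
  \<open>1\<close>-entries in all columns of \<open>T\<close>, so some row \<open>r\<close> has many \<open>1\<close>-entries and hardly any of the
  \<open>t\<close>-sets in its support is exceptional for \<open>r\<close>. Averaging gives a large constant-size subset of
  the support without exceptional \<open>t\<close>-sets. By Ramsey's theorem, with \<open>2 ^ L\<close> colours, we may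
  assume that all its \<open>t\<close>-sets have common rows at the same \<open>k\<close> scales to the left of \<open>r\<close>. Different
  scales are disjoint intervals of rows, so the rows of \<open>A\<close> can be chosen independently of each
  other, one from each scale, and they come out in the right order.\<close>

section \<open>Distances between rows, sorted by scale\<close>

definition left_scales :: "nat \<Rightarrow> nat set \<Rightarrow> nat \<Rightarrow> nat set" where
  "left_scales K D r = {l. \<exists>a\<in>D. a < r \<and> K ^ l \<le> r - a \<and> r - a < K ^ Suc l}"

lemma exists_scale:
  fixes K x :: nat
  assumes "1 \<le> x" "x < K ^ L"
  shows "\<exists>l<L. K ^ l \<le> x \<and> x < K ^ Suc l"
  using assms
proof (induction L)
  case (Suc L)
  then show ?case
    by (cases "x < K ^ L") (use less_SucI in \<open>blast, force\<close>)
qed simp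

lemma left_scales_subset:
  assumes "K > 0" "r < K ^ L"
  shows "left_scales K D r \<subseteq> {..<L}"
proof
  fix l assume "l \<in> left_scales K D r"
  then have "K ^ l < K ^ L"
    using assms by (auto simp: left_scales_def)
  then show "l \<in> {..<L}"
    using assms power_increasing[of L l K] by (force simp: not_less)
qed

text \<open>Induction that adds the largest scale \<open>x\<close> last. All of \<open>D\<close>
  lies within distance \<open>K ^ Suc x\<close> of its minimum, so it splits into \<open>K\<close>
  blocks \<open>E i\<close> of length \<open>K ^ x\<close>. Inside a block the differences are too
  small for scale \<open>x\<close>, so the induction hypothesis applies with one scale less.\<close>

lemma card_le_if_differences_in_scales:
  fixes D X :: "nat set"
  assumes "finite X" "finite D" "K > 0"
    and "\<And>a b. \<lbrakk>a \<in> D; b \<in> D; a < b\<rbrakk> \<Longrightarrow> \<exists>l\<in>X. K ^ l \<le> b - a \<and> b - a < K ^ Suc l"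
  shows "card D \<le> K ^ card X"
  using assms
proof (induction X arbitrary: D rule: finite_linorder_max_induct)
  case empty
  then have "\<And>a b. \<lbrakk>a \<in> D; b \<in> D\<rbrakk> \<Longrightarrow> a = b"
    by (metis empty_iff nat_neq_iff)
  with empty show ?case
    by (simp add: card_le_Suc0_iff_eq)
next
  case (insert x X)
  show ?case
  proof (cases "D = {}")
    case False
    define d where "d = Min D"
    define E where "E i = {a \<in> D. (a - d) div K ^ x = i}" for i
    have d: "d \<in> D" "\<And>a. a \<in> D \<Longrightarrow> d \<le> a"
      using False insert.prems unfolding d_def by auto
    have "a - d < K * K ^ x" if "a \<in> D" for a
    proof (cases "a = d")
      case False
      with d that obtain l where l: "l \<in> insert x X" "a - d < K ^ Suc l"
        using insert.prems(3)[of d a] by fastforce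
      then have "Suc l \<le> Suc x"
        using insert.hyps by auto
      then show ?thesis
        using less_le_trans[OF l(2) power_increasing[of "Suc l" "Suc x" K]] \<open>K > 0\<close> by auto
    qed (use \<open>K > 0\<close> in simp)
    then have "D \<subseteq> (\<Union>i<K. E i)"
      unfolding E_def by (auto intro: less_mult_imp_div_less)
    moreover have "finite (E i)" for i
      using insert.prems by (simp add: E_def)
    ultimately have "card D \<le> (\<Sum>i<K. card (E i))"
      using card_mono[of "\<Union>i<K. E i" D] card_UN_le[of "{..<K}" E] by (simp add: le_trans)
    also have "\<dots> \<le> (\<Sum>i<K. K ^ card X)"
    proof (rule sum_mono)
      fix i
      show "card (E i) \<le> K ^ card X"
      proof (rule insert.IH[OF \<open>finite (E i)\<close> \<open>K > 0\<close>])
        fix a b assume ab: "a \<in> E i" "b \<in> E i" "a < b"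
        then have D: "a \<in> D" "b \<in> D" and i: "(a - d) div K ^ x = i" "(b - d) div K ^ x = i"
          by (simp_all add: E_def)
        have "i * K ^ x \<le> a - d"
          unfolding i(1)[symmetric] by (rule div_times_less_eq_dividend)
        moreover have "b - d < i * K ^ x + K ^ x"
          using dividend_less_div_times[of "K ^ x" "b - d"] i(2) \<open>K > 0\<close> by simp
        ultimately have "b - a < K ^ x"
          using d(2)[OF D(1)] d(2)[OF D(2)] ab(3) by linarith
        then show "\<exists>l\<in>X. K ^ l \<le> b - a \<and> b - a < K ^ Suc l"
          using insert.prems(3)[OF D ab(3)] by auto
      qed
    qed
    finally show ?thesis
      using insert.hyps by (subst card_insert_disjoint) auto
  qed simp
qed

text \<open>Group the rows by their exact set \<open>X\<close> of left scales. If
  \<open>a < b\<close> are in the same group, then \<open>a\<close> itself witnesses that the scale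
  of \<open>b - a\<close> belongs to \<open>X\<close>, so the group has at most
  \<open>K ^ card X\<close> elements. There are at most \<open>2 ^ L\<close> groups.\<close>

lemma card_few_left_scales:
  assumes "K > 0" "D \<subseteq> {..<K ^ L}"
  shows "card {r \<in> D. card (left_scales K D r) < k} \<le> 2 ^ L * K ^ k"
proof -
  define F where "F = {X. X \<subseteq> {..<L} \<and> card X < k}"
  define E where "E X = {r \<in> D. left_scales K D r = X}" for X
  have "finite D"
    using assms finite_subset by blast
  then have fin: "finite F" "\<And>X. finite (E X)"
    by (auto simp: F_def E_def)
  have "{r \<in> D. card (left_scales K D r) < k} \<subseteq> (\<Union>X\<in>F. E X)"
    using left_scales_subset[OF assms(1)] assms(2) by (auto simp: F_def E_def subset_iff)
  then have "card {r \<in> D. card (left_scales K D r) < k} \<le> card (\<Union>X\<in>F. E X)"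
    using fin by (intro card_mono) auto
  also have "\<dots> \<le> (\<Sum>X\<in>F. card (E X))"
    using fin card_UN_le by blast
  also have "\<dots> \<le> (\<Sum>X\<in>F. K ^ k)"
  proof (rule sum_mono)
    fix X assume "X \<in> F"
    then have X: "X \<subseteq> {..<L}" "card X < k"
      by (auto simp: F_def)
    have "card (E X) \<le> K ^ card X"
    proof (rule card_le_if_differences_in_scales)
      fix a b assume ab: "a \<in> E X" "b \<in> E X" "a < b"
      then have "b - a < K ^ L" "1 \<le> b - a"
        using assms by (auto simp: E_def)
      then obtain l where "K ^ l \<le> b - a" "b - a < K ^ Suc l"
        using exists_scale by blast
      moreover from this have "l \<in> left_scales K D b"
        using ab by (auto simp: E_def left_scales_def)
      ultimately show "\<exists>l\<in>X. K ^ l \<le> b - a \<and> b - a < K ^ Suc l"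
        using ab(2) by (auto simp: E_def)
    qed (use X fin assms finite_subset[OF X(1)] in auto)
    also have "\<dots> \<le> K ^ k"
      using X assms by (intro power_increasing) auto
    finally show "card (E X) \<le> K ^ k" .
  qed
  also have "\<dots> \<le> 2 ^ L * K ^ k"
  proof -
    have "card F \<le> card (Pow {..<L})"
      by (intro card_mono) (auto simp: F_def)
    then show ?thesis
      by (simp add: card_Pow)
  qed
  finally show ?thesis .
qed

section \<open>Averaging and Ramsey's theorem\<close>

text \<open>A union bound: each \<open>T\<close> in \<open>B\<close> spoils
  \<open>(card N - t) choose (R - t)\<close> of the \<open>R\<close>-subsets. If all were spoilt,
  the identity \<open>choose_mult\<close> would contradict the bound on
  \<open>card B\<close>.\<close>

lemma exists_clean_subset:
  assumes "finite N" "B \<subseteq> nsets N t" "t \<le> R" "R \<le> card N"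
    and "card B * (R choose t) < card N choose t"
  shows "\<exists>U\<in>nsets N R. nsets U t \<inter> B = {}"
proof (rule ccontr)
  assume "\<not> ?thesis"
  then have cover: "nsets N R \<subseteq> (\<Union>T\<in>B. {U \<in> nsets N R. T \<subseteq> U})"
    by (fastforce simp: nsets_def)
  have "finite B"
    using assms finite_imp_finite_nsets finite_subset by metis
  have fin: "finite {U \<in> nsets N R. T \<subseteq> U}" for T
    using assms(1) by (simp add: finite_imp_finite_nsets)
  have "card {U \<in> nsets N R. T \<subseteq> U} \<le> (card N - t) choose (R - t)" if "T \<in> B" for T
  proof -
    have T: "T \<subseteq> N" "card T = t" "finite T"
      using assms that by (auto simp: nsets_def)
    have "card {U \<in> nsets N R. T \<subseteq> U} \<le> card (nsets (N - T) (R - t))"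
    proof (rule card_inj_on_le)
      show "inj_on (\<lambda>U. U - T) {U \<in> nsets N R. T \<subseteq> U}"
        by (rule inj_onI) blast
      show "(\<lambda>U. U - T) ` {U \<in> nsets N R. T \<subseteq> U} \<subseteq> nsets (N - T) (R - t)"
        using T by (auto simp: nsets_def card_Diff_subset)
    qed (use assms(1) in \<open>simp add: finite_imp_finite_nsets\<close>)
    then show ?thesis
      using T assms(1) by (simp add: card_Diff_subset)
  qed
  then have "(\<Sum>T\<in>B. card {U \<in> nsets N R. T \<subseteq> U}) \<le> (\<Sum>T\<in>B. (card N - t) choose (R - t))"
    by (rule sum_mono)
  moreover have "card N choose R \<le> (\<Sum>T\<in>B. card {U \<in> nsets N R. T \<subseteq> U})"
  proof -
    have "card (nsets N R) \<le> card (\<Union>T\<in>B. {U \<in> nsets N R. T \<subseteq> U})"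
      using cover fin \<open>finite B\<close> by (intro card_mono) auto
    also have "\<dots> \<le> (\<Sum>T\<in>B. card {U \<in> nsets N R. T \<subseteq> U})"
      using \<open>finite B\<close> card_UN_le by blast
    finally show ?thesis by simp
  qed
  ultimately have "card N choose R \<le> card B * ((card N - t) choose (R - t))"
    by simp
  then have "(card N choose R) * (R choose t) \<le> card B * ((card N - t) choose (R - t)) * (R choose t)"
    by simp
  then have "(card N choose t) * ((card N - t) choose (R - t))
      \<le> (card B * (R choose t)) * ((card N - t) choose (R - t))"
    unfolding choose_mult[OF assms(3,4), symmetric] by (simp only: ac_simps)
  moreover have "0 < (card N - t) choose (R - t)"
    using assms(3,4) by (simp add: diff_le_mono)
  ultimately show False
    using assms(5) by (meson mult_right_le_imp_le not_le)
qed

text \<open>Vertices and colours are renamed to initial segments of the naturals, where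
  \<open>partn_lst\<close> lives. \<open>R\<close> depends on neither \<open>U\<close> nor
  \<open>f\<close>, so it can be fixed before the matrix \<open>M\<close> is.\<close>

lemma ramsey_finite_colours:
  fixes F :: "'c set" and u t :: nat
  assumes "finite F"
  shows "\<exists>R. \<forall>(U :: 'a set) f. finite U \<longrightarrow> R \<le> card U \<longrightarrow> f \<in> nsets U t \<rightarrow> F \<longrightarrow>
    (\<exists>H\<in>nsets U u. \<exists>X. \<forall>T\<in>nsets H t. f T = X)"
proof -
  obtain R :: nat where R: "partn_lst {..<R} (replicate (card F) u) t"
    using ramsey_full by blast
  have "\<exists>H\<in>nsets U u. \<exists>X. \<forall>T\<in>nsets H t. f T = X"
    if U: "finite U" "R \<le> card U" "f \<in> nsets U t \<rightarrow> F" for U :: "'a set" and f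
  proof -
    obtain g where g: "bij_betw g F {..<card F}"
      using assms ex_bij_betw_finite_nat atLeast0LessThan by metis
    obtain e where e: "bij_betw e {..<card U} U"
      using U(1) ex_bij_betw_nat_finite atLeast0LessThan by metis
    have img: "(\<lambda>S. e ` S) \<in> nsets H t \<rightarrow> nsets (e ` H) t" if "H \<subseteq> {..<card U}" for H
    proof -
      have "inj_on e H"
        using e that bij_betw_def inj_on_subset by metis
      then have "inj_on e S" if "S \<subseteq> H" for S
        using that inj_on_subset by blast
      then show ?thesis
        by (auto simp: nsets_def card_image)
    qed
    have "(\<lambda>S. g (f (e ` S))) \<in> nsets {..<card U} t \<rightarrow> {..<card F}"
      using img[of "{..<card U}"] U(3) g e
      by (fastforce simp: Pi_iff bij_betw_def)
    then obtain i H where H: "H \<in> nsets {..<card U} u"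
      "(\<lambda>S. g (f (e ` S))) ` nsets H t \<subseteq> {i}" "i < card F"
      by (rule partn_lstE[OF partn_lst_greater_resource[OF R U(2)]]) auto
    have Hs: "H \<subseteq> {..<card U}"
      using H by (auto simp: nsets_def)
    then have inj: "inj_on e H"
      using e bij_betw_def inj_on_subset by metis
    have "e ` H \<in> nsets U u"
      using H(1) Hs inj image_mono[OF Hs, of e] bij_betw_imp_surj_on[OF e]
      by (auto simp: nsets_def card_image)
    moreover have "f T = inv_into F g i" if "T \<in> nsets (e ` H) t" for T
    proof -
      from that obtain S where S: "S \<subseteq> H" "T = e ` S"
        by (auto simp: nsets_def subset_image_iff)
      then have "inj_on e S"
        using inj inj_on_subset by blast
      then have "S \<in> nsets H t"
        using that S by (auto simp: nsets_def card_image finite_image_iff)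
      then have "g (f T) = i"
        using H S by auto
      moreover have "T \<in> nsets U t"
        using that \<open>e ` H \<in> nsets U u\<close> by (auto simp: nsets_def)
      ultimately show ?thesis
        using g U(3) by (metis Pi_mem bij_betw_def inv_into_f_f)
    qed
    ultimately show ?thesis by blast
  qed
  then show ?thesis by blast
qed

section \<open>Finding a copy of \<open>A\<close>\<close>

lemma pick_image_strict_mono:
  assumes "\<And>i j. \<lbrakk>i < j; j < k\<rbrakk> \<Longrightarrow> f i < f j" "i < k"
  shows "pick (f ` {..<k}) i = f i"
proof -
  have less: "f a < f b \<longleftrightarrow> a < b" if "a < k" "b < k" for a b
    using assms(1) that by (metis nat_neq_iff not_less_iff_gr_or_eq)
  then have "{a \<in> f ` {..<k}. a < f i} = f ` {..<i}"
    using assms(2) by auto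
  moreover have "inj_on f {..<i}"
    using less assms(2) by (intro inj_onI) (metis lessThan_iff less_trans nat_neq_iff)
  ultimately have "card {a \<in> f ` {..<k}. a < f i} = i"
    by (simp add: card_image)
  then show ?thesis
    using pick_card_in_set[of "f i" "f ` {..<k}"] assms(2) by simp
qed

text \<open>Rows are given by an increasing function because they get chosen one by one, columns by
  a set because they come from Ramsey's theorem.\<close>

lemma mat_containsI:
  assumes rows: "\<And>i. i < dim_row A \<Longrightarrow> f i < dim_row M"
    and mono: "\<And>i j. \<lbrakk>i < j; j < dim_row A\<rbrakk> \<Longrightarrow> f i < f j"
    and J: "J \<subseteq> {..<dim_col M}" "card J = dim_col A"
    and ones: "\<And>i j. \<lbrakk>i < dim_row A; j < dim_col A; A $$ (i, j) = 1\<rbrakk> \<Longrightarrow> M $$ (f i, pick J j) = 1"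
  shows "mat_contains M A"
proof -
  let ?I = "f ` {..<dim_row A}"
  have "inj_on f {..<dim_row A}"
    using mono by (intro inj_onI) (metis lessThan_iff nat_neq_iff)
  then have card: "card ?I = dim_row A"
    by (simp add: card_image)
  have "{i. i < dim_row M \<and> i \<in> ?I} = ?I" "{j. j < dim_col M \<and> j \<in> J} = J"
    using rows J by auto
  then have "dim_row (submatrix M ?I J) = dim_row A" "dim_col (submatrix M ?I J) = dim_col A"
    "\<And>i j. \<lbrakk>i < dim_row A; j < dim_col A\<rbrakk> \<Longrightarrow> submatrix M ?I J $$ (i, j) = M $$ (f i, pick J j)"
    using card J pick_image_strict_mono[where f = f, OF mono]
    by (simp_all add: dim_submatrix submatrix_index)
  then show ?thesis
    unfolding mat_contains_def Let_def using rows J ones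
    by (intro exI[of _ ?I] exI[of _ J]) auto
qed


definition ones_in_row :: "nat mat \<Rightarrow> nat \<Rightarrow> nat set" where
  "ones_in_row M i = {j. j < dim_col M \<and> M $$ (i, j) = 1}"

definition common_rows :: "nat mat \<Rightarrow> nat set \<Rightarrow> nat set" where
  "common_rows M T = {i. i < dim_row M \<and> (\<forall>j\<in>T. M $$ (i, j) = 1)}"

lemma finite_ones_in_row [simp]: "finite (ones_in_row M i)"
  by (simp add: ones_in_row_def)

lemma card_ones_in_row [simp]: "card (ones_in_row M i) = row_weight M i"
  by (simp add: ones_in_row_def row_weight_def)

lemma weight_eq_sum_row_weight: "weight M = (\<Sum>i<dim_row M. row_weight M i)"
proof -
  have "{(i, j). i < dim_row M \<and> j < dim_col M \<and> M $$ (i, j) = 1} = Sigma {..<dim_row M} (ones_in_row M)"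
    by (auto simp: ones_in_row_def)
  then show ?thesis
    by (simp add: weight_def card_SigmaI)
qed

text \<open>The additional \<open>t\<close> columns of \<open>U\<close> make room for padding: the
  at most \<open>t\<close> columns needed for a row of \<open>A\<close> extend to a
  \<open>t\<close>-set inside \<open>U\<close>. By uniformity, its common rows are present at every
  scale in \<open>X\<close>, so each row of \<open>A\<close> can be placed at a scale of its
  own.\<close>

lemma mat_contains_if_uniform_left_scales:
  assumes "K > 0" and U: "U \<in> nsets {..<dim_col M} (dim_col A + t)"
    and A: "\<And>i. i < dim_row A \<Longrightarrow> row_weight A i \<le> t"
    and X: "finite X" "dim_row A \<le> card X"
    and scales: "\<And>T. T \<in> nsets U t \<Longrightarrow> left_scales K (common_rows M T) r = X"
  shows "mat_contains M A"
proof -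
  have U': "U \<subseteq> {..<dim_col M}" "finite U" "card U = dim_col A + t"
    using U by (auto simp: nsets_def)
  then obtain J where J: "J \<subseteq> U" "card J = dim_col A"
    using obtain_subset_with_card_n[of "dim_col A" U] by (metis le_add1)
  have fJ: "finite J"
    using J U' finite_subset by blast
  \<comment> \<open>Larger scales lie further to the left of \<open>r\<close>, so the scales are used in decreasing order.\<close>
  define x where "x i = pick X (dim_row A - Suc i)" for i
  have xX: "x i \<in> X" if "i < dim_row A" for i
    using that X by (simp add: x_def pick_in_set_le)
  have x_mono: "x j < x i" if "i < j" "j < dim_row A" for i j
    unfolding x_def by (rule pick_mono_le) (use that X in auto)
  have "\<exists>f. f \<in> common_rows M (pick J ` ones_in_row A i) \<and> f < r \<and> K ^ x i \<le> r - f \<and> r - f < K ^ Suc (x i)"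
    if i: "i < dim_row A" for i
  proof -
    let ?S = "pick J ` ones_in_row A i"
    have S: "?S \<subseteq> U"
      using J by (auto simp: ones_in_row_def intro!: subsetD[OF J(1)] pick_in_set_le)
    have "card ?S \<le> t"
      using A[OF i] card_image_le[OF finite_ones_in_row, of "pick J" A i] by simp
    then obtain T where T: "?S \<subseteq> T" "T \<subseteq> U" "card T = t"
      using exists_subset_between[OF _ _ S, of t] U' by auto
    then have "T \<in> nsets U t"
      using U'(2) finite_subset by (auto simp: nsets_def)
    with xX[OF i] have "x i \<in> left_scales K (common_rows M T) r"
      using scales by simp
    moreover have "common_rows M T \<subseteq> common_rows M ?S"
      using T by (auto simp: common_rows_def)
    ultimately show ?thesis
      by (auto simp: left_scales_def)
  qed
  then obtain f where f: "\<And>i. i < dim_row A \<Longrightarrow> f i \<in> common_rows M (pick J ` ones_in_row A i)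
      \<and> f i < r \<and> K ^ x i \<le> r - f i \<and> r - f i < K ^ Suc (x i)"
    by metis
  show ?thesis
  proof (rule mat_containsI[where f = f and J = J])
    fix i j assume ij: "i < j" "j < dim_row A"
    have "r - f j < K ^ Suc (x j)"
      using f ij by blast
    also have "\<dots> \<le> K ^ x i"
      using x_mono[OF ij] \<open>K > 0\<close> by (intro power_increasing) auto
    also have "\<dots> \<le> r - f i"
      using f ij by simp
    finally show "f i < f j"
      by linarith
  qed (use f J U' in \<open>auto simp: common_rows_def ones_in_row_def\<close>)
qed

section \<open>Double counting rows and \<open>t\<close>-sets of columns\<close>

text \<open>The summand \<open>1\<close> takes care of \<open>d < t\<close>.\<close>

lemma power_le_binomial:
  fixes d t :: nat
  shows "d ^ t \<le> t ^ t * ((d choose t) + 1)"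
proof (cases "t \<le> d")
  case True
  show ?thesis
  proof (cases "t = 0")
    case False
    have "(real d / real t) ^ t \<le> real (d choose t)"
      using binomial_ge_n_over_k_pow_k[OF True, where 'a = real] .
    then have "real d ^ t \<le> real t ^ t * real (d choose t)"
      using False by (simp add: power_divide field_simps)
    then have "d ^ t \<le> t ^ t * (d choose t)"
      by (metis of_nat_le_iff of_nat_mult of_nat_power)
    then show ?thesis by simp
  qed simp
next
  case False
  then have "d ^ t \<le> t ^ t"
    by (intro power_mono) auto
  then show ?thesis by simp
qed

text \<open>The \<open>t\<close>-th moment counts, up to constants, the pairs of a row and a
  \<open>t\<close>-set in its support. In a heavy row a fixed proportion of these
  \<open>t\<close>-sets is exceptional, and each \<open>t\<close>-set is exceptional for few rows.
  The constant \<open>c\<close> is chosen before \<open>n\<close>, \<open>K\<close> and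
  \<open>M\<close>.\<close>

lemma sum_row_weight_power_le:
  assumes "t \<ge> 1" and A: "\<And>i. i < dim_row A \<Longrightarrow> row_weight A i \<le> t"
  obtains c :: nat where "\<And>n K M. \<lbrakk>K > 0; n \<le> K ^ L; M \<in> avoiding_mats n A\<rbrakk>
    \<Longrightarrow> (\<Sum>r<n. row_weight M r ^ t) \<le> c * K ^ dim_row A * n ^ t"
proof -
  define k where "k = dim_row A"
  define u where "u = dim_col A + t"
  have "\<exists>R'. \<forall>(U :: nat set) f. finite U \<longrightarrow> R' \<le> card U \<longrightarrow> f \<in> nsets U t \<rightarrow> Pow {..<L} \<longrightarrow>
    (\<exists>H\<in>nsets U u. \<exists>X. \<forall>T\<in>nsets H t. f T = X)"
    by (rule ramsey_finite_colours) simp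
  then obtain R' where R': "\<forall>(U :: nat set) f. finite U \<longrightarrow> R' \<le> card U \<longrightarrow> f \<in> nsets U t \<rightarrow> Pow {..<L} \<longrightarrow>
    (\<exists>H\<in>nsets U u. \<exists>X. \<forall>T\<in>nsets H t. f T = X)" ..
  \<comment> \<open>The maximum with \<open>t\<close> secures the hypothesis
    \<open>t \<le> R\<close> of \<open>exists_clean_subset\<close>.\<close>
  define R where "R = max R' t"
  define b where "b = R choose t"
  \<comment> \<open>In the constant, \<open>b * 2 ^ L\<close> pays for the exceptional pairs,
    \<open>b\<close> for the rows of weight below \<open>R\<close>, and \<open>1\<close> for the
    extra summand in \<open>power_le_binomial\<close>.\<close>
  show ?thesis
  proof (rule that[of "t ^ t * (1 + b * (2 ^ L + 1))"])
    fix n K M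
    assume "K > 0" and n: "n \<le> K ^ L" and M: "M \<in> avoiding_mats n A"
    have dim: "dim_row M = n" "dim_col M = n" and avoid: "\<not> mat_contains M A"
      using M by (auto simp: avoiding_mats_def)
    define sparse where "sparse r T \<longleftrightarrow> card (left_scales K (common_rows M T) r) < k" for r T
    define bad where "bad r = {T \<in> nsets (ones_in_row M r) t. sparse r T}" for r

    \<comment> \<open>Otherwise some \<open>R\<close>-subset of the support has no exceptional
      \<open>t\<close>-set, and a Ramsey-uniform subset of it yields a copy of
      \<open>A\<close>.\<close>
    have many_bad: "row_weight M r choose t \<le> card (bad r) * b" if r: "r < n" "R \<le> row_weight M r" for r
    proof (rule ccontr)
      assume "\<not> ?thesis"
      then obtain U where U: "U \<in> nsets (ones_in_row M r) R" "nsets U t \<inter> bad r = {}"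
        using exists_clean_subset[of "ones_in_row M r" "bad r" t R] r
        by (auto simp: b_def R_def bad_def)
      let ?f = "\<lambda>T. left_scales K (common_rows M T) r"
      have f: "?f T \<subseteq> {..<L}" for T
        using r n by (intro left_scales_subset[OF \<open>K > 0\<close>]) simp
      have "finite U" "R' \<le> card U"
        using U(1) by (auto simp: nsets_def R_def)
      moreover have "?f \<in> nsets U t \<rightarrow> Pow {..<L}"
        using f by blast
      ultimately obtain H X where H: "H \<in> nsets U u" "\<And>T. T \<in> nsets H t \<Longrightarrow> ?f T = X"
        using R'[rule_format, of U ?f] by blast
      have sub: "nsets H t \<subseteq> nsets U t" "nsets U t \<subseteq> nsets (ones_in_row M r) t"
        using H(1) U(1) by (auto simp: nsets_def)
      \<comment> \<open>The colour \<open>X\<close> is known only through a \<open>t\<close>-subset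
        of \<open>H\<close>; one exists since \<open>u \<ge> t\<close>.\<close>
      have "nsets H t \<noteq> {}"
        using H(1) unfolding nsets_eq_empty_iff by (simp add: nsets_def u_def)
      then obtain T where T: "T \<in> nsets H t" "T \<in> nsets U t"
        using sub by blast
      then have "\<not> sparse r T"
        using U(2) sub by (auto simp: bad_def)
      then have "k \<le> card X"
        using H(2)[OF T(1)] by (simp add: sparse_def)
      moreover have "X \<subseteq> {..<L}"
        using H(2)[OF T(1)] f by blast
      moreover have "H \<in> nsets {..<dim_col M} (dim_col A + t)"
        using H(1) U(1) by (auto simp: nsets_def u_def ones_in_row_def)
      ultimately have "mat_contains M A"
        using mat_contains_if_uniform_left_scales[OF \<open>K > 0\<close> _ A _ _ H(2)]
          finite_subset[OF _ finite_lessThan] unfolding k_def by blast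
      with avoid show False ..
    qed
    have choose_le: "row_weight M r choose t \<le> (card (bad r) + 1) * b" if "r < n" for r
    proof (cases "R \<le> row_weight M r")
      case True
      with many_bad[OF that] show ?thesis by simp
    next
      case False
      then have "row_weight M r choose t \<le> b"
        unfolding b_def by (intro binomial_right_mono) auto
      then show ?thesis by simp
    qed

    have "(\<Sum>r<n. card (bad r)) = (\<Sum>r<n. \<Sum>T\<in>nsets {..<n} t. of_bool (T \<in> bad r))"
    proof (rule sum.cong)
      fix r
      have "bad r \<subseteq> nsets {..<n} t"
        using dim by (auto simp: bad_def nsets_def ones_in_row_def)
      then show "card (bad r) = (\<Sum>T\<in>nsets {..<n} t. of_bool (T \<in> bad r))"
        by (simp add: sum.If_cases of_bool_def finite_imp_finite_nsets Int_absorb1)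
    qed simp
    also have "\<dots> = (\<Sum>T\<in>nsets {..<n} t. \<Sum>r<n. of_bool (T \<in> bad r))"
      by (rule sum.swap)
    also have "\<dots> \<le> (\<Sum>T\<in>nsets {..<n} t. 2 ^ L * K ^ k)"
    proof (rule sum_mono)
      fix T assume "T \<in> nsets {..<n} t"
      have "(\<Sum>r<n. of_bool (T \<in> bad r)) = card {r. r < n \<and> T \<in> bad r}"
        by (simp add: sum.If_cases of_bool_def Int_def)
      \<comment> \<open>If \<open>T\<close> lies in the support of row \<open>r\<close>, then
        \<open>r\<close> is itself a common row of \<open>T\<close>, so
        \<open>card_few_left_scales\<close> applies with \<open>D = common_rows M T\<close>.\<close>
      also have "\<dots> \<le> card {r \<in> common_rows M T. card (left_scales K (common_rows M T) r) < k}"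
        using dim by (intro card_mono)
          (auto simp: bad_def sparse_def common_rows_def nsets_def ones_in_row_def)
      also have "\<dots> \<le> 2 ^ L * K ^ k"
        using \<open>K > 0\<close> n dim by (intro card_few_left_scales) (auto simp: common_rows_def)
      finally show "(\<Sum>r<n. of_bool (T \<in> bad r)) \<le> 2 ^ L * K ^ k" .
    qed
    also have "\<dots> \<le> n ^ t * (2 ^ L * K ^ k)"
      by (cases "t \<le> n") (auto intro: binomial_le_pow simp: binomial_eq_0)
    finally have bad: "(\<Sum>r<n. card (bad r)) \<le> n ^ t * (2 ^ L * K ^ k)" .

    \<comment> \<open>This absorbs the contributions that are constant per row.\<close>
    have n': "n \<le> n ^ t * K ^ k"
    proof (cases "n = 0")
      case False
      then have "n ^ 1 * 1 \<le> n ^ t * K ^ k"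
        using \<open>t \<ge> 1\<close> \<open>K > 0\<close> by (intro mult_mono power_increasing) auto
      then show ?thesis by simp
    qed simp
    have "(\<Sum>r<n. row_weight M r ^ t) \<le> (\<Sum>r<n. t ^ t * ((card (bad r) + 1) * b + 1))"
      using choose_le by (intro sum_mono order_trans[OF power_le_binomial] mult_left_mono) auto
    also have "\<dots> = t ^ t * (((\<Sum>r<n. card (bad r)) + n) * b + n)"
      by (simp add: sum_distrib_left[symmetric] sum_distrib_right[symmetric] sum.distrib algebra_simps)
    also have "\<dots> \<le> t ^ t * ((n ^ t * (2 ^ L * K ^ k) + n ^ t * K ^ k) * b + n ^ t * K ^ k)"
      using bad n' by (intro mult_left_mono add_mono mult_right_mono) auto
    also have "\<dots> = t ^ t * (1 + b * (2 ^ L + 1)) * K ^ k * n ^ t"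
      by (simp add: algebra_simps)
    finally show "(\<Sum>r<n. row_weight M r ^ t) \<le> t ^ t * (1 + b * (2 ^ L + 1)) * K ^ dim_row A * n ^ t"
      by (simp add: k_def)
  qed
qed

section \<open>From the moment to the weight\<close>

text \<open>A cheap substitute for the power mean inequality, from
  \<open>d \<le> x + d ^ t / x ^ (t - 1)\<close>.\<close>

lemma sum_le_of_sum_power_le:
  fixes d :: "'a \<Rightarrow> real" and x :: real
  assumes "x > 0" "t \<ge> 1" "\<And>r. r \<in> S \<Longrightarrow> d r \<ge> 0"
    and "(\<Sum>r\<in>S. d r ^ t) \<le> real (card S) * x ^ t"
  shows "(\<Sum>r\<in>S. d r) \<le> 2 * real (card S) * x"
proof -
  have t: "x ^ t = x ^ (t - 1) * x" "\<And>r. d r ^ t = d r ^ (t - 1) * d r"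
    using \<open>t \<ge> 1\<close> by (metis Suc_diff_1 less_eq_Suc_le One_nat_def power_Suc2)+
  have "(\<Sum>r\<in>S. d r) \<le> (\<Sum>r\<in>S. x + d r ^ t / x ^ (t - 1))"
  proof (rule sum_mono)
    fix r assume "r \<in> S"
    show "d r \<le> x + d r ^ t / x ^ (t - 1)"
    proof (cases "d r \<le> x")
      case True
      then show ?thesis
        using assms \<open>r \<in> S\<close> by (simp add: add_increasing2)
    next
      case False
      then have "x ^ (t - 1) * d r \<le> d r ^ t"
        unfolding t using assms(1) by (intro mult_right_mono power_mono) auto
      then have "d r \<le> d r ^ t / x ^ (t - 1)"
        using \<open>x > 0\<close> by (simp add: field_simps)
      then show ?thesis
        using \<open>x > 0\<close> by linarith
    qed
  qed
  also have "\<dots> = real (card S) * x + (\<Sum>r\<in>S. d r ^ t) / x ^ (t - 1)"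
    by (simp add: sum.distrib sum_divide_distrib)
  also have "\<dots> \<le> real (card S) * x + real (card S) * x ^ t / x ^ (t - 1)"
    using assms by (intro add_left_mono divide_right_mono) auto
  also have "\<dots> = 2 * real (card S) * x"
    using \<open>x > 0\<close> by (simp add: t(1))
  finally show ?thesis .
qed

lemma weight_le_of_avoiding:
  assumes "t \<ge> 1" and A: "\<And>i. i < dim_row A \<Longrightarrow> row_weight A i \<le> t"
  obtains c :: real where "c > 0" "\<And>n K M. \<lbrakk>K > 0; n \<le> K ^ L; 0 < n; M \<in> avoiding_mats n A\<rbrakk>
    \<Longrightarrow> real (weight M) \<le> c * real K ^ dim_row A * real n powr (2 - 1 / real t)"
proof -
  obtain c :: nat where c: "\<And>n K M. \<lbrakk>K > 0; n \<le> K ^ L; M \<in> avoiding_mats n A\<rbrakk>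
    \<Longrightarrow> (\<Sum>r<n. row_weight M r ^ t) \<le> c * K ^ dim_row A * n ^ t"
    using sum_row_weight_power_le[OF assms, where L = L] by blast
  show ?thesis
  proof (rule that[of "2 * real (c + 1)"])
    fix n K M assume K: "K > 0" "n \<le> K ^ L" and "0 < n" and M: "M \<in> avoiding_mats n A"
    \<comment> \<open>The \<open>+ 1\<close> ensures \<open>Q \<ge> 1\<close>, hence
      \<open>Q \<le> Q ^ t\<close>, so no \<open>t\<close>-th root of \<open>Q\<close> is needed.
      The loss is only a factor depending on \<open>c\<close> and a power of \<open>K\<close>, and
      \<open>K\<close> will be a small power of \<open>n\<close>.\<close>
    define Q where "Q = real (c + 1) * real K ^ dim_row A"
    have Q: "Q \<ge> 1"
      unfolding Q_def using K(1) mult_mono[of 1 "real (c + 1)" 1 "real K ^ dim_row A"] by simp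
    define x where "x = Q * real n powr (1 - 1 / real t)"
    have "x > 0"
      using Q \<open>0 < n\<close> by (simp add: x_def)
    have "real n * x ^ t = Q ^ t * real n ^ t"
    proof -
      have "(real n powr (1 - 1 / real t)) ^ t = real n powr (real t - 1)"
        using \<open>0 < n\<close> \<open>t \<ge> 1\<close> by (simp add: powr_power right_diff_distrib)
      moreover have "real n * real n powr (real t - 1) = real n ^ t"
        using \<open>0 < n\<close> by (simp add: powr_diff powr_realpow)
      ultimately show ?thesis
        by (simp add: x_def power_mult_distrib)
    qed
    have "real (\<Sum>r<n. row_weight M r ^ t) \<le> real (c * K ^ dim_row A * n ^ t)"
      using c[OF K M] by (rule of_nat_mono)
    also have "\<dots> \<le> Q * real n ^ t"
      by (auto simp: Q_def intro!: mult_right_mono)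
    also have "\<dots> \<le> Q ^ t * real n ^ t"
      using Q \<open>t \<ge> 1\<close> power_increasing[of 1 t Q] by (intro mult_right_mono) auto
    also have "\<dots> = real (card {..<n}) * x ^ t"
      using \<open>real n * x ^ t = _\<close> by simp
    finally have "(\<Sum>r<n. real (row_weight M r)) \<le> 2 * real (card {..<n}) * x"
      using \<open>x > 0\<close> \<open>t \<ge> 1\<close> by (intro sum_le_of_sum_power_le) auto
    also have "\<dots> = 2 * Q * (real n * real n powr (1 - 1 / real t))"
      by (simp add: x_def)
    also have "real n * real n powr (1 - 1 / real t) = real n powr (2 - 1 / real t)"
      using \<open>0 < n\<close> powr_add[of "real n" 1 "1 - 1 / real t"] by simp
    finally have "(\<Sum>r<n. real (row_weight M r))
        \<le> 2 * real (c + 1) * real K ^ dim_row A * real n powr (2 - 1 / real t)"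
      by (simp only: Q_def mult.assoc)
    moreover have "dim_row M = n"
      using M by (auto simp: avoiding_mats_def)
    ultimately show "real (weight M) \<le> 2 * real (c + 1) * real K ^ dim_row A * real n powr (2 - 1 / real t)"
      by (simp only: weight_eq_sum_row_weight of_nat_sum)
  qed simp
qed

section \<open>Choice of \<open>L\<close> and \<open>K\<close>\<close>

theorem theorem1p4:
  fixes t :: nat and A :: "nat mat"
  assumes "t \<ge> 1"
    and "zero_one_mat A"
    and "\<forall>i<dim_row A. row_weight A i \<le> t"
  shows "\<forall>\<epsilon>>0. \<exists>n\<^sub>0. \<forall>n\<ge>n\<^sub>0.
           real (extremal_number n A) \<le> real n powr (2 - 1 / real t + \<epsilon>)"
proof (intro allI impI)
  fix \<epsilon> :: real assume "\<epsilon> > 0"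
  define k where "k = dim_row A"
  \<comment> \<open>With \<open>K\<close> about \<open>n\<close> to the power \<open>1 / L\<close>,
    the loss \<open>K ^ k\<close> is about \<open>n\<close> to the power \<open>k / L\<close>.
    Strictness of \<open>k / L < \<epsilon>\<close> leaves room for the constant
    \<open>c * 2 ^ k\<close>.\<close>
  obtain L :: nat where L: "real k / \<epsilon> < real L" "L > 0"
    by (metis of_nat_0_less_iff reals_Archimedean2 max_less_iff_conj)
  then have kL: "real k / real L < \<epsilon>"
    using \<open>\<epsilon> > 0\<close> by (simp add: field_simps)
  obtain c :: real where "c > 0" and c: "\<And>n K M. \<lbrakk>K > 0; n \<le> K ^ L; 0 < n; M \<in> avoiding_mats n A\<rbrakk>
    \<Longrightarrow> real (weight M) \<le> c * real K ^ k * real n powr (2 - 1 / real t)"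
    using weight_le_of_avoiding[OF \<open>t \<ge> 1\<close>, where A = A and L = L] assms(3) unfolding k_def by blast
  have "eventually (\<lambda>n. c * 2 ^ k * real n powr (real k / real L) \<le> real n powr \<epsilon>) at_top"
    using \<open>c > 0\<close> kL by real_asymp
  then obtain n0 where n0: "\<And>n. n \<ge> n0 \<Longrightarrow> c * 2 ^ k * real n powr (real k / real L) \<le> real n powr \<epsilon>"
    by (auto simp: eventually_at_top_linorder)
  show "\<exists>n\<^sub>0. \<forall>n\<ge>n\<^sub>0. real (extremal_number n A) \<le> real n powr (2 - 1 / real t + \<epsilon>)"
  proof (intro exI[of _ "max n0 1"] allI impI)
    fix n assume n: "max n0 1 \<le> n"
    define y where "y = real n powr (1 / real L)"
    \<comment> \<open>Rounding up at most doubles \<open>y\<close>, because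
      \<open>y \<ge> 1\<close>; this is the source of the factor \<open>2 ^ k\<close>.\<close>
    define K where "K = nat \<lceil>y\<rceil>"
    have "1 \<le> y"
      using n by (simp add: y_def ge_one_powr_ge_zero)
    then have K: "K > 0" "y \<le> real K" "real K \<le> 2 * y"
      unfolding K_def by linarith+
    have "real n = y ^ L"
      using n \<open>L > 0\<close> by (simp add: y_def powr_power)
    also have "\<dots> \<le> real (K ^ L)"
      using K \<open>1 \<le> y\<close> by (simp add: power_mono)
    finally have nK: "n \<le> K ^ L"
      by simp
    have bound: "real (weight M) \<le> real n powr (2 - 1 / real t + \<epsilon>)" if "M \<in> avoiding_mats n A" for M
    proof -
      have "real (weight M) \<le> c * real K ^ k * real n powr (2 - 1 / real t)"
        using c[OF K(1) nK _ that] n by simp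
      also have "\<dots> \<le> c * (2 * y) ^ k * real n powr (2 - 1 / real t)"
        using K \<open>c > 0\<close> by (intro mult_right_mono mult_left_mono power_mono) auto
      also have "(2 * y) ^ k = 2 ^ k * real n powr (real k / real L)"
        using n by (simp add: y_def power_mult_distrib powr_power)
      also have "c * (2 ^ k * real n powr (real k / real L)) * real n powr (2 - 1 / real t)
          \<le> real n powr \<epsilon> * real n powr (2 - 1 / real t)"
        using n0[of n] n by (intro mult_right_mono) (auto simp: mult.assoc)
      also have "\<dots> = real n powr (2 - 1 / real t + \<epsilon>)"
        by (simp add: powr_add[symmetric] add.commute)
      finally show ?thesis .
    qed
    show "real (extremal_number n A) \<le> real n powr (2 - 1 / real t + \<epsilon>)"
    proof (cases "avoiding_mats n A = {}")
      \<comment> \<open>Here the extremal number is \<open>0\<close>, the value of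
        \<open>Sup\<close> on the empty set.\<close>
      case True
      then show ?thesis
        by (simp add: extremal_number_def Sup_nat_def)
    next
      case False
      then have "extremal_number n A \<in> weight ` avoiding_mats n A"
        using finite_weight_avoiding_mats by (simp add: extremal_number_eq_Max)
      then show ?thesis
        using bound by auto
    qed
  qed
qed

end
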